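(* Let $X=\{x_1,\dots,x_M\}\subset\mathbb{R}^d$ be a finite set of $M$ points and let $\mu$ be the discrete measure supported at $X$ with corresponding positive weights (masses) $\boldsymbol{\lambda}=\{\lambda_i\}$, $\lambda_i>0$, $i=1,\dots,M$. Let $K\supseteq X$ with $K\subseteq\mathbb{R}^d$, let $S=\mathrm{span}(\phi_1,\dots,\phi_L)$ be a finite dimensional space of real-valued functions defined on $K$, and let $N=\dim(S|_X)\le L$. Then there exist $m\le N$, nodes $T=\{t_j\}_{1\le j\le m}\subseteq X$ and positive weights $\boldsymbol{w}=\{w_j\}_{1\le j\le m}$ such that $$\int_X f(x)\,d\mu=\sum_{i=1}^M\lambda_i f(x_i)=\sum_{j=1}^m w_j f(t_j)\qquad\forall f\in S|_X .$$
   Context: $S|_X$ denotes the space of restrictions to $X$ of the functions in $S$. For a function $f$ on $X$, $\int_X f\,d\mu$ means $\sum_{i=1}^M\lambda_i f(x_i)$. *)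

theory Defs
  imports "HOL-Analysis.Analysis" "HOL-Library.Function_Algebras"
begin

text \<open>
  Functions into a real vector space form a real vector space pointwise, so that the
  library's \<open>span\<close> and \<open>dim\<close> apply to sets of functions.
\<close>

instantiation "fun" :: (type, real_vector) real_vector
begin

definition scaleR_fun :: "real \<Rightarrow> ('a \<Rightarrow> 'b) \<Rightarrow> 'a \<Rightarrow> 'b" where
  "scaleR_fun c f = (\<lambda>x. c *\<^sub>R f x)"

instance
  by standard (auto simp: scaleR_fun_def fun_eq_iff algebra_simps)

end

text \<open>
  A function defined on a set \<open>A\<close> is represented by its extension by zero outside \<open>A\<close>.
  These extensions form a linear subspace isomorphic to the space of all functions on \<open>A\<close>.
  (The library's \<open>restrict\<close> uses the value \<open>undefined\<close> instead, and its image is not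
  closed under pointwise addition.)
\<close>

definition restr :: "'a set \<Rightarrow> ('a \<Rightarrow> real) \<Rightarrow> 'a \<Rightarrow> real" where
  "restr A f = (\<lambda>x. if x \<in> A then f x else 0)"

text \<open>
  The mass of \<open>x i\<close> is \<open>lam i\<close>; this is meant for \<open>x\<close> injective on \<open>{1..M}\<close>.
\<close>

definition discrete_measure ::
    "nat \<Rightarrow> (nat \<Rightarrow> 'a) \<Rightarrow> (nat \<Rightarrow> real) \<Rightarrow> 'a measure" where
  "discrete_measure M x lam =
     point_measure (x ` {1..M}) (\<lambda>y. ennreal (lam (the_inv_into {1..M} x y)))"

lemma integral_discrete_measure:
  fixes f :: "'a \<Rightarrow> real"
  assumes "inj_on x {1..M}" "\<And>i. i \<in> {1..M} \<Longrightarrow> 0 < lam i"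
  shows "(\<integral>y. f y \<partial>discrete_measure M x lam) = (\<Sum>i=1..M. lam i * f (x i))"
proof -
  have "(\<integral>y. f y \<partial>discrete_measure M x lam) =
      (\<Sum>y\<in>x ` {1..M}. lam (the_inv_into {1..M} x y) * f y)"
    unfolding discrete_measure_def
    using assms
    by (subst lebesgue_integral_point_measure_finite)
       (auto simp: the_inv_into_f_f less_imp_le)
  also have "\<dots> = (\<Sum>i=1..M. lam i * f (x i))"
    using assms(1) by (simp add: sum.reindex the_inv_into_f_f)
  finally show ?thesis .
qed

end

theory Submission
  imports Defs
begin

text \<open>
  Evaluating a basis of \<open>S|\<^sub>X\<close> at the points of \<open>X\<close> turns the integral into a positive combination of
  vectors in an \<open>N\<close>-dimensional space.  By the conic form of Caratheodory's theorem it is a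
  positive combination of linearly independent ones among them, so of at most \<open>N\<close>.
\<close>

lemma dependent_family_relation:
  fixes e :: "'a \<Rightarrow> 'v::real_vector"
  assumes "finite T" "\<not> (inj_on e T \<and> independent (e ` T))"
  obtains c t where "(\<Sum>s\<in>T. c s *\<^sub>R e s) = 0" "t \<in> T" "0 < (c t :: real)"
proof -
  have "\<exists>c. (\<Sum>s\<in>T. c s *\<^sub>R e s) = 0 \<and> (\<exists>t\<in>T. c t \<noteq> (0::real))"
  proof (cases "inj_on e T")
    case True
    with assms have "dependent (e ` T)" by simp
    then obtain u where u: "\<exists>v\<in>e ` T. u v \<noteq> 0" "(\<Sum>v\<in>e ` T. u v *\<^sub>R v) = 0"
      using assms(1) by (auto simp: dependent_finite)
    then show ?thesis
      using True by (intro exI[of _ "u \<circ> e"]) (auto simp: sum.reindex)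
  next
    case False
    then obtain p q where pq: "p \<in> T" "q \<in> T" "p \<noteq> q" "e p = e q"
      by (auto simp: inj_on_def)
    \<comment> \<open>These are the coefficients of the relation
      \<open>e p - e q = 0\<close>.\<close>
    define c :: "'a \<Rightarrow> real" where "c s = (if s = p then 1 else 0) - (if s = q then 1 else 0)" for s
    have "(\<Sum>s\<in>T. c s *\<^sub>R e s) =
        (\<Sum>s\<in>T. if s = p then e s else 0) - (\<Sum>s\<in>T. if s = q then e s else 0)"
      unfolding sum_subtractf[symmetric] by (rule sum.cong) (auto simp: c_def)
    also have "\<dots> = 0"
      using pq assms(1) by (simp add: sum.delta)
    finally show ?thesis
      using pq by (intro exI[of _ c]) (auto simp: c_def)
  qed
  then obtain c t where c: "(\<Sum>s\<in>T. c s *\<^sub>R e s) = 0" "t \<in> T" "c t \<noteq> (0::real)"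
    by blast
  show ?thesis
  proof (cases "0 < c t")
    case True
    with c that show ?thesis by blast
  next
    case False
    with c that[of "\<lambda>s. - c s" t] show ?thesis by (simp add: sum_negf)
  qed
qed

text \<open>Induction on the number of vectors: subtracting a multiple of a linear relation leaves
  the sum unchanged, and a suitable multiple makes some coefficient vanish while none becomes
  negative.\<close>

lemma conic_caratheodory:
  fixes e :: "'a \<Rightarrow> 'v::real_vector" and a :: "'a \<Rightarrow> real"
  assumes "finite T" "\<And>s. s \<in> T \<Longrightarrow> 0 < a s"
  shows "\<exists>U w. U \<subseteq> T \<and> inj_on e U \<and> independent (e ` U) \<and> (\<forall>s\<in>U. 0 < w s) \<and>
    (\<Sum>s\<in>U. w s *\<^sub>R e s) = (\<Sum>s\<in>T. a s *\<^sub>R e s)"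
  using assms
proof (induction "card T" arbitrary: T a rule: less_induct)
  case less
  show ?case
  proof (cases "inj_on e T \<and> independent (e ` T)")
    case True
    with less.prems show ?thesis by blast
  next
    case False
    then obtain c t where c: "(\<Sum>s\<in>T. c s *\<^sub>R e s) = 0" "t \<in> T" "0 < (c t :: real)"
      using dependent_family_relation less.prems(1) by blast
    let ?P = "{s \<in> T. 0 < c s}"
    \<comment> \<open>The largest multiple of \<open>c\<close> that can be subtracted from
      \<open>a\<close> without making a coefficient negative; only indices with
      \<open>c s > 0\<close> constrain it.\<close>
    define r where "r = Min ((\<lambda>s. a s / c s) ` ?P)"
    have fin: "finite ((\<lambda>s. a s / c s) ` ?P)" and ne: "(\<lambda>s. a s / c s) ` ?P \<noteq> {}"
      using less.prems(1) c by auto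
    from Min_in[OF fin ne] obtain p where p: "p \<in> T" "0 < c p" "r = a p / c p"
      by (auto simp: r_def)
    have "0 < r"
      using p less.prems(2) by simp
    define b where "b s = a s - r * c s" for s
    have b_nonneg: "0 \<le> b s" if "s \<in> T" for s
    proof (cases "0 < c s")
      case True
      with that fin have "r \<le> a s / c s"
        unfolding r_def by (intro Min_le) auto
      with True show ?thesis by (simp add: b_def field_simps)
    next
      case False
      with \<open>0 < r\<close> have "r * c s \<le> 0" by (simp add: mult_nonneg_nonpos)
      with less.prems(2)[OF that] show ?thesis by (simp add: b_def)
    qed
    have "b p = 0"
      using p by (simp add: b_def)
    \<comment> \<open>Dropping all zero coefficients, not just that of the minimizer
      \<open>p\<close>, restores strict positivity for the induction hypothesis.\<close>
    define T' where "T' = {s \<in> T. b s \<noteq> 0}"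
    have "T' \<subset> T"
      using \<open>b p = 0\<close> p by (auto simp: T'_def)
    then have "card T' < card T" "finite T'"
      using less.prems(1) by (auto intro: psubset_card_mono finite_subset)
    moreover have "0 < b s" if "s \<in> T'" for s
      using that b_nonneg[of s] by (simp add: T'_def)
    ultimately obtain U w where U: "U \<subseteq> T'" "inj_on e U" "independent (e ` U)" "\<forall>s\<in>U. 0 < w s"
      "(\<Sum>s\<in>U. w s *\<^sub>R e s) = (\<Sum>s\<in>T'. b s *\<^sub>R e s)"
      using less.hyps by metis
    have "(\<Sum>s\<in>T'. b s *\<^sub>R e s) = (\<Sum>s\<in>T. b s *\<^sub>R e s)"
      by (rule sum.mono_neutral_left) (auto simp: T'_def less.prems(1))
    also have "\<dots> = (\<Sum>s\<in>T. a s *\<^sub>R e s) - r *\<^sub>R (\<Sum>s\<in>T. c s *\<^sub>R e s)"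
      by (simp add: b_def algebra_simps sum_subtractf scaleR_sum_right)
    finally show ?thesis
      using U \<open>T' \<subset> T\<close> c(1) by (metis diff_zero psubset_imp_subset scaleR_zero_right subset_trans)
  qed
qed

lemma sum_apply:
  fixes g :: "'i \<Rightarrow> 'a \<Rightarrow> 'b::comm_monoid_add"
  shows "(\<Sum>i\<in>I. g i) y = (\<Sum>i\<in>I. g i y)"
  by (induction I rule: infinite_finite_induct) auto

text \<open>Each point is replaced by its vector of values on \<open>B\<close>. These vectors lie in
  a space of dimension at most \<open>card B\<close>, so the reduction to independent ones leaves at
  most that many nodes. Equality of the vector sums is exactness on \<open>B\<close>, which extends
  to the span by linearity.\<close>

lemma positive_quadrature:
  fixes B :: "('a \<Rightarrow> real) set" and a :: "'a \<Rightarrow> real"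
  assumes "finite B" "finite T" "\<And>s. s \<in> T \<Longrightarrow> 0 < a s"
  shows "\<exists>U w. U \<subseteq> T \<and> card U \<le> card B \<and> (\<forall>s\<in>U. 0 < w s) \<and>
    (\<forall>f\<in>span B. (\<Sum>s\<in>U. w s * f s) = (\<Sum>s\<in>T. a s * f s))"
proof -
  \<comment> \<open>\<open>e s\<close> is evaluation at \<open>s\<close>, set to zero off
    \<open>B\<close> so that it is a combination of the finitely many unit vectors
    \<open>d f\<close> with \<open>f\<close> in \<open>B\<close>.\<close>
  define e :: "'a \<Rightarrow> ('a \<Rightarrow> real) \<Rightarrow> real" where "e s = (\<lambda>f. if f \<in> B then f s else 0)" for s
  define d :: "('a \<Rightarrow> real) \<Rightarrow> ('a \<Rightarrow> real) \<Rightarrow> real" where "d f = (\<lambda>g. if g = f then 1 else 0)" for f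
  obtain U w where U: "U \<subseteq> T" "inj_on e U" "independent (e ` U)" "\<forall>s\<in>U. 0 < w s"
    and eq: "(\<Sum>s\<in>U. w s *\<^sub>R e s) = (\<Sum>s\<in>T. a s *\<^sub>R e s)"
    using conic_caratheodory[where e = e and a = a, OF assms(2,3)] by blast
  have "e s = (\<Sum>f\<in>B. f s *\<^sub>R d f)" for s
  proof
    fix g
    have "(\<Sum>f\<in>B. f s *\<^sub>R d f) g = (\<Sum>f\<in>B. if g = f then f s else 0)"
      unfolding sum_apply by (rule sum.cong) (auto simp: scaleR_fun_def d_def)
    then show "e s g = (\<Sum>f\<in>B. f s *\<^sub>R d f) g"
      using assms(1) by (simp add: e_def)
  qed
  then have "e s \<in> span (d ` B)" for s
    by (metis (no_types, lifting) imageI span_base span_scale span_sum)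
  then have "card (e ` U) \<le> card (d ` B)"
    using independent_span_bound[OF _ U(3), of "d ` B"] assms(1) by auto
  \<comment> \<open>Injectivity of \<open>e\<close> on \<open>U\<close> turns the bound on the
    number of vectors into one on the number of nodes.\<close>
  then have "card U \<le> card B"
    using card_image_le[OF assms(1), of d] card_image[OF U(2)] by simp
  moreover have "(\<Sum>s\<in>U. w s * f s) = (\<Sum>s\<in>T. a s * f s)" if "f \<in> span B" for f
    using that
  proof (induction rule: span_induct_alt)
    case base
    show ?case by simp
  next
    case (step c f g)
    \<comment> \<open>As \<open>f\<close> lies in \<open>B\<close>, this is the
      \<open>f\<close>-coordinate of \<open>eq\<close>.\<close>
    have "(\<Sum>s\<in>U. w s * f s) = (\<Sum>s\<in>T. a s * f s)"
      using fun_cong[OF eq, of f] step by (simp add: sum_apply scaleR_fun_def e_def)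
    moreover have "(\<Sum>s\<in>A. v s * (c *\<^sub>R f + g) s) = c * (\<Sum>s\<in>A. v s * f s) + (\<Sum>s\<in>A. v s * g s)"
      for A and v :: "'a \<Rightarrow> real"
      by (simp add: scaleR_fun_def algebra_simps sum.distrib sum_distrib_left)
    ultimately show ?case
      using step by simp
  qed
  ultimately show ?thesis
    using U by blast
qed

lemma linear_restr: "linear (restr A)"
  by (rule linearI) (auto simp: restr_def scaleR_fun_def fun_eq_iff)

theorem theorem1:
  fixes M L N :: nat
    and x :: "nat \<Rightarrow> real ^ 'd"
    and lam :: "nat \<Rightarrow> real"
    and X K :: "(real ^ 'd) set"
    and \<mu> :: "(real ^ 'd) measure"
    and \<phi> :: "nat \<Rightarrow> real ^ 'd \<Rightarrow> real"
    and S :: "(real ^ 'd \<Rightarrow> real) set"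
  assumes X: "X = x ` {1..M}" "inj_on x {1..M}"
    and lam: "\<And>i. i \<in> {1..M} \<Longrightarrow> 0 < lam i"
    and mu: "\<mu> = discrete_measure M x lam"
    and K: "X \<subseteq> K"
    and S: "S = span ((\<lambda>i. restr K (\<phi> i)) ` {1..L})"
    and N: "N = dim (restr X ` S)"
  shows "N \<le> L \<and>
    (\<exists>m (t :: nat \<Rightarrow> real ^ 'd) (w :: nat \<Rightarrow> real).
       m \<le> N \<and> inj_on t {1..m} \<and> t ` {1..m} \<subseteq> X \<and> (\<forall>j\<in>{1..m}. 0 < w j) \<and>
       (\<forall>f\<in>restr X ` S.
          (\<integral>y. f y \<partial>\<mu>) = (\<Sum>i=1..M. lam i * f (x i)) \<and>
          (\<Sum>i=1..M. lam i * f (x i)) = (\<Sum>j=1..m. w j * f (t j))))"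
proof -
  define G where "G = restr X ` (\<lambda>i. restr K (\<phi> i)) ` {1..L}"
  have G: "finite G" "card G \<le> L"
    using card_image_le[of "{1..L}" "\<lambda>i. restr X (restr K (\<phi> i))"] by (auto simp: G_def image_image)
  have V: "restr X ` S = span G"
    by (simp add: G_def S linear_span_image[OF linear_restr])
  have "N \<le> L"
    using G dim_le_card[of "restr X ` S" G] by (simp add: V N)
  \<comment> \<open>A basis, in place of the generating set \<open>G\<close>, brings the number of
    nodes down from \<open>L\<close> to \<open>N\<close>.\<close>
  obtain B where B: "B \<subseteq> restr X ` S" "independent B" "restr X ` S \<subseteq> span B" "card B = N"
    using basis_exists[of "restr X ` S"] N by metis
  \<comment> \<open>An infinite set has \<open>card\<close> 0, so finiteness does not follow from
    \<open>card B = N\<close>; it comes from independence inside the span of the finite set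
    \<open>G\<close>.\<close>
  have "finite B"
    using independent_span_bound[OF G(1) B(2)] B(1) V by simp
  \<comment> \<open>The masses become a function of the point instead of its index; this is well
    defined because \<open>x\<close> is injective.\<close>
  define a where "a = lam \<circ> the_inv_into {1..M} x"
  have a: "a (x i) = lam i" if "i \<in> {1..M}" for i
    using that X(2) by (simp add: a_def the_inv_into_f_f)
  have "finite X" and a_pos: "\<And>s. s \<in> X \<Longrightarrow> 0 < a s"
    using X lam a by auto
  obtain U w where U: "U \<subseteq> X" "card U \<le> card B" "\<forall>s\<in>U. 0 < w s"
    and quad: "\<forall>f\<in>span B. (\<Sum>s\<in>U. w s * f s) = (\<Sum>s\<in>X. a s * f s)"
    using positive_quadrature[OF \<open>finite B\<close> \<open>finite X\<close>, of a] a_pos by blast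
  have "finite U"
    using U(1) \<open>finite X\<close> by (rule finite_subset)
  then obtain t where t: "bij_betw t {1..card U} U"
    using ex_bij_betw_nat_finite_1 by blast
  have "(\<Sum>i=1..M. lam i * f (x i)) = (\<Sum>j=1..card U. w (t j) * f (t j))" if "f \<in> restr X ` S" for f
  proof -
    have "(\<Sum>i=1..M. lam i * f (x i)) = (\<Sum>s\<in>X. a s * f s)"
      using X by (simp add: sum.reindex a)
    also have "\<dots> = (\<Sum>s\<in>U. w s * f s)"
      using quad B(3) that by auto
    also have "\<dots> = (\<Sum>j=1..card U. w (t j) * f (t j))"
      using sum.reindex_bij_betw[OF t, of "\<lambda>s. w s * f s"] by simp
    finally show ?thesis .
  qed
  moreover have "\<forall>j\<in>{1..card U}. 0 < (w \<circ> t) j"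
    using U(3) bij_betwE[OF t] by simp
  moreover have "inj_on t {1..card U}" "t ` {1..card U} \<subseteq> X"
    using t U(1) by (auto simp: bij_betw_def)
  ultimately show ?thesis
    using \<open>N \<le> L\<close> U(2) B(4) integral_discrete_measure[OF X(2) lam]
    by (intro conjI exI[of _ "card U"] exI[of _ t] exI[of _ "w \<circ> t"]) (auto simp: mu)
qed

end
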